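(* Let $G^{1\ldots k}$ be a system of $k$ networks with user set $U$, let $G$ be the coupled network produced from $G^{1\ldots k}$ by the clique lossless coupling scheme, let $S=\{s_1,\ldots,s_p\}\subseteq U$ be a seed set, and let $d\ge 1$ be an integer. If $A^d(G^{1\ldots k},S)=\{a_1,a_2,\ldots,a_q\}$ is the set of users active after $d$ propagation hops in $G^{1\ldots k}$ when started from $S$, then the set of vertices active after $2d$ propagation hops in $G$, when started from the seed set of gateway vertices $\{s_1^0,\ldots,s_p^0\}$, is exactly $$\{a_1^0,a_1^1,\ldots,a_1^k,\ \ldots,\ a_q^0,a_q^1,\ldots,a_q^k\}.$$
   Context: Multiplex system. $G^{1\ldots k}$ consists of $k$ finite weighted directed graphs $G^i=(V^i,E^i,\theta^i,W^i)$, $1\le i\le k$, without self-loops, with edge weights $w^i(u,v)\ge 0$ for $(u,v)\in E^i$ and a threshold $\theta^i(u)$ for each $u\in V^i$. The same user may belong to several $V^i$. $U=\bigcup_{i=1}^k V^i$ is the set of all users. $N_u^{i-}$ is the set of in-neighbors of $u$ in $G^i$. Propagation in the system (Linear Threshold model). Given a seed set $S\subseteq U$, the users in $S$ are active at time $0$ and all others inactive. Active users remain active. At time $t\ge1$ an inactive user $u$ becomes active iff there is some $i$ with $u\in V^i$ and $\sum_{v\in N_u^{i-}\cap A} w^i(v,u)\ge\theta^i(u)$, where $A$ is the set of users active after time $t-1$. $A^d(G^{1\ldots k},S)$ is the set of users active after $d$ time steps (propagation hops). Propagation in a single network is the case $k=1$ of this. Clique lossless coupling scheme. The coupled network $G$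 is the following single weighted directed graph with thresholds. For each user $u\in U$ there are $k+1$ vertices: a gateway vertex $u^0$ and representative vertices $u^1,\ldots,u^k$. If $u\notin V^i$, then $u^i$ is called a dummy vertex. Thresholds: $\theta(u^0)=1$; $\theta(u^i)=1$ if $u^i$ is a dummy vertex; $\theta(u^i)=\theta^i(u)$ if $u\in V^i$. Edges: for every $(u,v)\in E^i$ there is an edge $(u^0,v^i)$ with weight $w(u^0,v^i)=w^i(u,v)$; and for every user $u$ and all $0\le i,j\le k$ with $i\ne j$ there is an edge $(u^i,u^j)$ with weight $w(u^i,u^j)=\theta(u^j)$. There are no other edges. *)

theory Defs
  imports "Graph_Theory.Pair_Digraph" "Graph_Theory.Weighted_Graph"
begin

record 'v network = "'v pair_pre_digraph" +
  weight :: "('v \<times> 'v) weight_fun"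
  threshold :: "'v \<Rightarrow> real"

text \<open>
  \<^const>\<open>pair_digraph\<close> comprises finiteness, absence of loops and arcs between vertices only.
  Thresholds are arbitrary reals.
\<close>

definition network :: "'v network \<Rightarrow> bool" where
  "network N \<longleftrightarrow> pair_digraph (pair_pre_digraph.truncate N) \<and> (\<forall>e \<in> parcs N. 0 \<le> weight N e)"

definition in_neighbors :: "'v network \<Rightarrow> 'v \<Rightarrow> 'v set" where
  "in_neighbors N u = {v. (v, u) \<in> parcs N}"

text \<open>Only the indices in \<open>{1..k}\<close> of a family of networks are relevant below.\<close>

definition multiplex :: "nat \<Rightarrow> (nat \<Rightarrow> 'v network) \<Rightarrow> bool" where
  "multiplex k G \<longleftrightarrow> (\<forall>i \<in> {1..k}. network (G i))"

definition users :: "nat \<Rightarrow> (nat \<Rightarrow> 'v network) \<Rightarrow> 'v set" where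
  "users k G = (\<Union>i \<in> {1..k}. pverts (G i))"

primrec active :: "nat \<Rightarrow> (nat \<Rightarrow> 'v network) \<Rightarrow> 'v set \<Rightarrow> nat \<Rightarrow> 'v set" where
  "active k G S 0 = S"
| "active k G S (Suc t) = active k G S t \<union>
     {u. \<exists>i \<in> {1..k}. u \<in> pverts (G i) \<and>
       threshold (G i) u \<le> (\<Sum>v \<in> in_neighbors (G i) u \<inter> active k G S t. weight (G i) (v, u))}"

definition active_single :: "'v network \<Rightarrow> 'v set \<Rightarrow> nat \<Rightarrow> 'v set" where
  "active_single N S d = active 1 (\<lambda>_. N) S d"

text \<open>
  The vertex \<open>(u, 0)\<close> is the gateway of user \<open>u\<close>; \<open>(u, i)\<close> for \<open>1 \<le> i \<le> k\<close> is the representative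
  of \<open>u\<close> in network \<open>i\<close>, a dummy if \<open>u \<notin> pverts (G i)\<close>.
\<close>

definition gateway :: "'v \<Rightarrow> 'v \<times> nat" where
  "gateway u = (u, 0)"

fun coupled_threshold :: "(nat \<Rightarrow> 'v network) \<Rightarrow> 'v \<times> nat \<Rightarrow> real" where
  "coupled_threshold G (u, i) = (if i \<noteq> 0 \<and> u \<in> pverts (G i) then threshold (G i) u else 1)"

text \<open>
  As the networks have no loops, an arc of the coupled network joins two copies of the same user
  iff it is a clique arc, so the case distinction on \<open>u = v\<close> tells the two kinds of arcs apart.
\<close>

fun coupled_weight :: "(nat \<Rightarrow> 'v network) \<Rightarrow> ('v \<times> nat) \<times> ('v \<times> nat) \<Rightarrow> real" where
  "coupled_weight G ((u, i), (v, j)) =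
     (if u = v then coupled_threshold G (v, j) else weight (G j) (u, v))"

definition clique_coupling :: "nat \<Rightarrow> (nat \<Rightarrow> 'v network) \<Rightarrow> ('v \<times> nat) network" where
  "clique_coupling k G =
     \<lparr> pverts = users k G \<times> {0..k},
       parcs = {(gateway u, (v, i)) | u v i. i \<in> {1..k} \<and> (u, v) \<in> parcs (G i)}
             \<union> {((u, i), (u, j)) | u i j. u \<in> users k G \<and> i \<le> k \<and> j \<le> k \<and> i \<noteq> j},
       weight = coupled_weight G,
       threshold = coupled_threshold G \<rparr>"

end

(*
  Two hops in the coupled network simulate one hop in the multiplex system. In the first hop the
  gateways of the active users A act through the copied arcs and activate exactly those
  representatives whose threshold is met in their own network; no gateway outside A is activated.
  In the second hop the clique arcs spread the activation of one copy of a user to all of its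
  copies, while the influence along copied arcs is unchanged. A representative with a negative
  threshold is no obstacle to clique spreading, since it is always activated in the first hop.
*)

theory Submission
  imports Defs
begin

section \<open>One hop of the multiplex system\<close>

definition influence :: "'v network \<Rightarrow> 'v set \<Rightarrow> 'v \<Rightarrow> real" where
  "influence N A u = (\<Sum>v \<in> in_neighbors N u \<inter> A. weight N (v, u))"

text \<open>The index of the network whose threshold is met is kept: for a user outside
  \<open>A\<close>, exactly the representatives with such an index, and no other copies, become
  active in the first of the two coupled hops.\<close>

definition triggered :: "nat \<Rightarrow> (nat \<Rightarrow> 'v network) \<Rightarrow> 'v set \<Rightarrow> ('v \<times> nat) set" where
  "triggered k G A =
     {(u, i). i \<in> {1..k} \<and> u \<in> pverts (G i) \<and> threshold (G i) u \<le> influence (G i) A u}"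

definition hop :: "nat \<Rightarrow> (nat \<Rightarrow> 'v network) \<Rightarrow> 'v set \<Rightarrow> 'v set" where
  "hop k G A = A \<union> fst ` triggered k G A"

lemma active_Suc_hop: "active k G S (Suc t) = hop k G (active k G S t)"
  by (force simp: hop_def triggered_def influence_def)

lemma active_single_Suc:
  "active_single N S (Suc t) = active_single N S t \<union>
     {x \<in> pverts N. threshold N x \<le> influence N (active_single N S t) x}"
  by (auto simp: active_single_def influence_def)

section \<open>Consequences of nonnegative weights and absence of loops\<close>

lemma networkD:
  assumes "network N"
  shows network_finite_arcs: "finite (parcs N)"
    and network_arc_verts: "(u, v) \<in> parcs N \<Longrightarrow> u \<in> pverts N \<and> v \<in> pverts N"
    and network_no_loops: "(u, u) \<notin> parcs N"
    and network_weight_nonneg: "e \<in> parcs N \<Longrightarrow> 0 \<le> weight N e"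
proof -
  interpret pair_digraph "pair_pre_digraph.truncate N"
    using assms by (simp add: network_def)
  show "finite (parcs N)"
    using pair_finite_arcs by (simp add: pair_pre_digraph.defs)
  show "(u, v) \<in> parcs N \<Longrightarrow> u \<in> pverts N \<and> v \<in> pverts N"
    using in_arcsD1[of u v] in_arcsD2[of u v] by (simp add: pair_pre_digraph.defs)
  show "(u, u) \<notin> parcs N"
    using no_loops'[of u u] by (auto simp: pair_pre_digraph.defs)
  show "e \<in> parcs N \<Longrightarrow> 0 \<le> weight N e"
    using assms by (simp add: network_def)
qed

lemma finite_in_neighbors: "network N \<Longrightarrow> finite (in_neighbors N u)"
  by (rule finite_subset[of _ "fst ` parcs N"])
     (force simp: in_neighbors_def network_finite_arcs)+

lemma influence_nonneg: "network N \<Longrightarrow> 0 \<le> influence N A u"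
  unfolding influence_def
  by (rule sum_nonneg) (auto simp: in_neighbors_def network_weight_nonneg)

lemma users_hop: "A \<subseteq> users k G \<Longrightarrow> hop k G A \<subseteq> users k G"
  by (auto simp: hop_def triggered_def users_def)

lemma users_active: "S \<subseteq> users k G \<Longrightarrow> active k G S t \<subseteq> users k G"
  by (induction t) (simp_all add: active_Suc_hop users_hop del: active.simps(2))

section \<open>Influence on a vertex of the coupled network\<close>

lemma pverts_clique_coupling: "pverts (clique_coupling k G) = users k G \<times> {0..k}"
  by (simp add: clique_coupling_def)

lemma threshold_clique_coupling: "threshold (clique_coupling k G) = coupled_threshold G"
  by (simp add: clique_coupling_def)

lemma in_neighbors_clique_coupling:
  assumes "v \<in> users k G" "j \<le> k"
  shows "in_neighbors (clique_coupling k G) (v, j) =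
    (if j = 0 then {} else gateway ` in_neighbors (G j) v) \<union> {v} \<times> ({0..k} - {j})"
  using assms by (auto simp: in_neighbors_def clique_coupling_def)

text \<open>Every clique arc into \<open>(v, j)\<close> carries the threshold of its own target, so
  the active other copies of \<open>v\<close> matter only through their number; the copied arcs
  reproduce the influence in the original network.\<close>

lemma influence_clique_coupling:
  assumes "multiplex k G" "v \<in> users k G" "j \<le> k"
  shows "influence (clique_coupling k G) X (v, j) =
    (if j = 0 then 0 else influence (G j) (gateway -` X) v)
      + real (card {i \<in> {0..k} - {j}. (v, i) \<in> X}) * coupled_threshold G (v, j)"
proof -
  define P where "P = (if j = 0 then {} else gateway ` (in_neighbors (G j) v \<inter> gateway -` X))"
  define Q where "Q = Pair v ` {i \<in> {0..k} - {j}. (v, i) \<in> X}"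
  have net: "network (G j)" if "j \<noteq> 0"
    using assms that by (auto simp: multiplex_def)
  \<comment> \<open>Serves twice: it makes the gateways in \<open>P\<close> belong to users other
    than \<open>v\<close>, hence disjoint from \<open>Q\<close>, and it makes
    \<open>coupled_weight\<close> select the original weights on \<open>P\<close>.\<close>
  have loopfree: "v \<notin> in_neighbors (G j) v" if "j \<noteq> 0"
    using network_no_loops[OF net[OF that]] by (simp add: in_neighbors_def)
  have split: "in_neighbors (clique_coupling k G) (v, j) \<inter> X = P \<union> Q"
    unfolding in_neighbors_clique_coupling[OF assms(2,3)] P_def Q_def by auto
  have "P \<inter> Q = {}"
    using loopfree by (auto simp: P_def Q_def gateway_def)
  moreover have "finite P" "finite Q"
    using finite_in_neighbors[OF net] by (auto simp: P_def Q_def)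
  ultimately have "influence (clique_coupling k G) X (v, j) =
      (\<Sum>x\<in>P. coupled_weight G (x, (v, j))) + (\<Sum>x\<in>Q. coupled_weight G (x, (v, j)))"
    unfolding influence_def split by (simp add: sum.union_disjoint clique_coupling_def)
  also have "(\<Sum>x\<in>P. coupled_weight G (x, (v, j))) =
      (if j = 0 then 0 else influence (G j) (gateway -` X) v)"
  proof (cases "j = 0")
    case False
    have "(\<Sum>x\<in>P. coupled_weight G (x, (v, j))) =
        (\<Sum>u \<in> in_neighbors (G j) v \<inter> gateway -` X. coupled_weight G (gateway u, (v, j)))"
      using False by (simp add: P_def sum.reindex inj_on_def gateway_def)
    also have "\<dots> = influence (G j) (gateway -` X) v"
      unfolding influence_def using loopfree[OF False]
      by (intro sum.cong) (auto simp: gateway_def)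
    finally show ?thesis using False by simp
  qed (simp add: P_def)
  also have "(\<Sum>x\<in>Q. coupled_weight G (x, (v, j))) =
      real (card {i \<in> {0..k} - {j}. (v, i) \<in> X}) * coupled_threshold G (v, j)"
    by (simp add: Q_def sum.reindex inj_on_def del: coupled_threshold.simps)
  finally show ?thesis .
qed

lemma influence_dummy:
  assumes "network N" "u \<notin> pverts N"
  shows "influence N A u = 0"
proof -
  have "in_neighbors N u = {}"
    using network_arc_verts[OF assms(1)] assms(2) by (auto simp: in_neighbors_def)
  then show ?thesis by (simp add: influence_def)
qed

text \<open>Without active copies the clique arcs contribute nothing. Gateways and dummies then
  receive influence 0, below their threshold 1, so only genuine representatives can react.\<close>

lemma clique_coupling_inactive_user:
  assumes "multiplex k G" "v \<in> users k G" "j \<le> k" "\<And>i. (v, i) \<notin> X"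
  shows "threshold (clique_coupling k G) (v, j) \<le> influence (clique_coupling k G) X (v, j)
    \<longleftrightarrow> (v, j) \<in> triggered k G (gateway -` X)"
proof -
  have "network (G j)" if "j \<noteq> 0"
    using assms that by (auto simp: multiplex_def)
  then show ?thesis
    using assms(3,4) influence_dummy[of "G j" v]
    by (auto simp: influence_clique_coupling[OF assms(1-3)] triggered_def threshold_clique_coupling)
qed

text \<open>One active copy contributes exactly the threshold. Further copies do no harm if the
  threshold is nonnegative, but each one lowers the influence if it is negative; hence the last
  hypothesis.\<close>

lemma clique_coupling_active_copy:
  assumes "multiplex k G" "v \<in> users k G" "j \<le> k" "i \<le> k" "i \<noteq> j" "(v, i) \<in> X"
    and "coupled_threshold G (v, j) < 0 \<Longrightarrow> card {i \<in> {0..k} - {j}. (v, i) \<in> X} = 1"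
  shows "threshold (clique_coupling k G) (v, j) \<le> influence (clique_coupling k G) X (v, j)"
proof -
  let ?m = "card {i \<in> {0..k} - {j}. (v, i) \<in> X}" and ?\<theta> = "coupled_threshold G (v, j)"
  have "1 \<le> ?m"
    using assms by (auto simp: Suc_le_eq card_gt_0_iff)
  have "?\<theta> \<le> real ?m * ?\<theta>"
  proof (cases "?\<theta> < 0")
    case False
    then show ?thesis
      using \<open>1 \<le> ?m\<close> mult_right_mono[of 1 "real ?m" ?\<theta>] by simp
  qed (use assms(7) in simp)
  moreover have "0 \<le> (if j = 0 then 0 else influence (G j) (gateway -` X) v)"
    using assms by (auto simp: multiplex_def intro: influence_nonneg)
  ultimately show ?thesis
    unfolding influence_clique_coupling[OF assms(1-3)] threshold_clique_coupling by simp
qed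

section \<open>Two coupled hops simulate one multiplex hop\<close>

lemma set_eq_on_Times:
  assumes "L \<subseteq> A \<times> B" "R \<subseteq> A \<times> B"
    and "\<And>a b. a \<in> A \<Longrightarrow> b \<in> B \<Longrightarrow> (a, b) \<in> L \<longleftrightarrow> (a, b) \<in> R"
  shows "L = R"
  using assms by blast

text \<open>Seeding activates gateways only, while later rounds start from all copies of the active
  users. Both shapes of \<open>X\<close> have the same gateways and so trigger the same
  representatives; in the former the clique arcs also fill in the missing copies.\<close>

lemma clique_coupling_first_hop:
  assumes "multiplex k G" "A \<subseteq> users k G" "X = gateway ` A \<or> X = A \<times> {0..k}"
  shows "X \<union> {x \<in> pverts (clique_coupling k G).
      threshold (clique_coupling k G) x \<le> influence (clique_coupling k G) X x}
    = A \<times> {0..k} \<union> triggered k G A" (is "?L = ?R")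
proof -
  have X: "gateway -` X = A" "X \<subseteq> A \<times> {0..k}"
    using assms(3) by (auto simp: gateway_def)
  have trig: "triggered k G A \<subseteq> users k G \<times> {0..k}"
    by (auto simp: triggered_def users_def)
  have agree: "(v, j) \<in> ?L \<longleftrightarrow> (v, j) \<in> ?R"
    if v: "v \<in> users k G" and j_range: "j \<in> {0..k}" for v j
  proof -
    have j: "j \<le> k" using j_range by simp
    show ?thesis
    proof (cases "v \<in> A")
      case True
      have "threshold (clique_coupling k G) (v, j) \<le> influence (clique_coupling k G) X (v, j)"
        if new: "(v, j) \<notin> X"
      proof -
        have X_eq: "X = gateway ` A"
          using assms(3) True new j by auto
        then have "j \<noteq> 0"
          using True new by (auto simp: gateway_def)
        \<comment> \<open>The gateway is the only active copy of \<open>v\<close>, so the clique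
          contribution equals the threshold even when that is negative.\<close>
        then have "{i \<in> {0..k} - {j}. (v, i) \<in> X} = {0}"
          using True by (auto simp: X_eq gateway_def)
        then show ?thesis
          using clique_coupling_active_copy[OF assms(1) v j, of 0 X] \<open>j \<noteq> 0\<close> True
          by (auto simp: X_eq gateway_def)
      qed
      then show ?thesis
        using True v j by (auto simp: pverts_clique_coupling)
    next
      case False
      then have "\<And>i. (v, i) \<notin> X" using X(2) by auto
      then show ?thesis
        using clique_coupling_inactive_user[OF assms(1) v j, of X] False v j X(1)
        by (auto simp: pverts_clique_coupling)
    qed
  qed
  have bounds: "?L \<subseteq> users k G \<times> {0..k}" "?R \<subseteq> users k G \<times> {0..k}"
    using X(2) assms(2) trig by (auto simp: pverts_clique_coupling)
  show ?thesis by (rule set_eq_on_Times[OF bounds agree])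
qed

lemma clique_coupling_second_hop:
  assumes "multiplex k G" "A \<subseteq> users k G"
  defines "Y \<equiv> A \<times> {0..k} \<union> triggered k G A"
  shows "Y \<union> {x \<in> pverts (clique_coupling k G).
      threshold (clique_coupling k G) x \<le> influence (clique_coupling k G) Y x}
    = hop k G A \<times> {0..k}" (is "?L = ?R")
proof -
  \<comment> \<open>Indices in \<open>triggered\<close> start at 1, so no gateway is added and the
    copied arcs still transmit the influence of \<open>A\<close>.\<close>
  have gw: "gateway -` Y = A"
    by (auto simp: Y_def gateway_def triggered_def)
  have Y: "Y \<subseteq> hop k G A \<times> {0..k}"
    by (force simp: Y_def hop_def triggered_def)
  have agree: "(v, j) \<in> ?L \<longleftrightarrow> (v, j) \<in> ?R"
    if v: "v \<in> users k G" and j_range: "j \<in> {0..k}" for v j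
  proof -
    have j: "j \<le> k" using j_range by simp
    show ?thesis
    proof (cases "v \<in> hop k G A")
      case True
      have "threshold (clique_coupling k G) (v, j) \<le> influence (clique_coupling k G) Y (v, j)"
        if new: "(v, j) \<notin> Y"
      proof -
        \<comment> \<open>For a user of \<open>A\<close> any index up to \<open>k\<close> serves;
          otherwise it is that of a network in which the threshold is met.\<close>
        obtain i where i: "(v, i) \<in> Y" "i \<le> k"
          using True by (force simp: hop_def Y_def triggered_def)
        \<comment> \<open>Only a genuine representative can have a negative threshold; its
          nonnegative network influence would already have put it into \<open>Y\<close>.\<close>
        have "0 \<le> coupled_threshold G (v, j)"
        proof (rule ccontr)
          assume neg: "\<not> 0 \<le> coupled_threshold G (v, j)"
          then have *: "j \<in> {1..k}" "v \<in> pverts (G j)" "threshold (G j) v < 0"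
            using j by (auto split: if_splits)
          then have "0 \<le> influence (G j) A v"
            using assms(1) by (auto simp: multiplex_def intro: influence_nonneg)
          then have "(v, j) \<in> triggered k G A"
            using * by (auto simp: triggered_def)
          then show False using new by (simp add: Y_def)
        qed
        then show ?thesis
          using clique_coupling_active_copy[OF assms(1) v j i(2) _ i(1)] i(1) new by force
      qed
      then show ?thesis
        using True v j by (auto simp: pverts_clique_coupling)
    next
      case False
      then have "\<And>i. (v, i) \<notin> Y" using Y by auto
      moreover have "(v, j) \<notin> triggered k G A" using False by (force simp: hop_def)
      ultimately show ?thesis
        using clique_coupling_inactive_user[OF assms(1) v j, of Y] False gw by auto
    qed
  qed
  have bounds: "?L \<subseteq> users k G \<times> {0..k}" "?R \<subseteq> users k G \<times> {0..k}"
    using Y users_hop[OF assms(2)] by (auto simp: pverts_clique_coupling)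
  show ?thesis by (rule set_eq_on_Times[OF bounds agree])
qed

lemma active_single_clique_coupling_Suc_Suc:
  assumes "multiplex k G" "A \<subseteq> users k G"
    and "active_single (clique_coupling k G) T t \<in> {gateway ` A, A \<times> {0..k}}"
  shows "active_single (clique_coupling k G) T (Suc (Suc t)) = hop k G A \<times> {0..k}"
proof -
  have "active_single (clique_coupling k G) T (Suc t) = A \<times> {0..k} \<union> triggered k G A"
    unfolding active_single_Suc
    by (rule clique_coupling_first_hop) (use assms in auto)
  then show ?thesis
    unfolding active_single_Suc[of _ _ "Suc t"]
    by (simp only: clique_coupling_second_hop[OF assms(1,2)])
qed

theorem theorem1:
  fixes k d :: nat and G :: "nat \<Rightarrow> 'v network" and S :: "'v set"
  assumes "multiplex k G" and "S \<subseteq> users k G" and "1 \<le> d"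
  shows "active_single (clique_coupling k G) (gateway ` S) (2 * d)
           = {(a, i) | a i. a \<in> active k G S d \<and> i \<le> k}"
proof -
  \<comment> \<open>The product form can fail at time 0, where only gateways are active, so the
    induction starts after the first simulated hop.\<close>
  have "active_single (clique_coupling k G) (gateway ` S) (2 * Suc t)
      = active k G S (Suc t) \<times> {0..k}" for t
  proof (induction t)
    case 0
    have "active_single (clique_coupling k G) (gateway ` S) 0 = gateway ` S"
      by (simp add: active_single_def)
    then have "active_single (clique_coupling k G) (gateway ` S) (Suc (Suc 0)) = hop k G S \<times> {0..k}"
      by (intro active_single_clique_coupling_Suc_Suc assms) simp
    then show ?case
      unfolding active_Suc_hop by (simp add: numeral_2_eq_2)
  next
    case (Suc t)
    have "active_single (clique_coupling k G) (gateway ` S) (Suc (Suc (2 * Suc t)))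
        = hop k G (active k G S (Suc t)) \<times> {0..k}"
      by (rule active_single_clique_coupling_Suc_Suc[OF assms(1) users_active[OF assms(2)]])
         (simp only: Suc.IH, simp)
    then show ?case
      unfolding active_Suc_hop[of _ _ _ "Suc t"] by simp
  qed
  from this[of "d - 1"] show ?thesis
    using assms(3) by auto
qed

end
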